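(* Let $f$ and $g$ be probability density functions on $[0,1]$, let $n\ge 1$ be an integer, let $M_0,\dots,M_{n-1}$ be real numbers with $M_j\ge \left|\langle x^j\rangle_f-\langle x^j\rangle_g\right|$ for $0\le j\le n-1$, let $R_n=\langle x^{n-1}\rangle_f+\langle x^{n-1}\rangle_g$, and let $\varepsilon>0$. Then there exists a unique positive real solution $K$ of the equation $$\frac{1}{\pi}\left\{M_0K+\frac{M_1}{2!}K^2+\frac{M_2}{3!}K^3+\dots+\frac{M_{n-1}}{n!}K^n+\frac{R_n}{(n+1)!}K^{n+1}\right\}-\varepsilon=0,$$ and this $K$ is a cut-off (inverse length) scale at which $f$ and $g$ are similar up to tolerance $\varepsilon$, i.e. the low-pass filtered functions $f^<=P_K[f]$ and $g^<=P_K[g]$ satisfy $d(f^<,g^<)\le\varepsilon$.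
   Context: A probability density function (PDF) on $[0,1]$ is a nonnegative Lebesgue-integrable function $f:[0,1]\to\mathbb{R}$ with $\int_0^1 f(x)\,dx=1$. Its $j$-th moment is $\langle x^j\rangle_f=\int_0^1 x^jf(x)\,dx$. Its characteristic function is $F(k)=\int_0^1 e^{ikx}f(x)\,dx$ for $k\in\mathbb{R}$; similarly $G$ is the characteristic function of $g$. For $K>0$ the low-pass filter at inverse length scale $K$ is $$P_K[f](x)=f^<(x)=\frac{1}{2\pi}\int_{-K}^{K}e^{-ikx}F(k)\,dk,$$ and likewise $g^<(x)=P_K[g](x)=\frac{1}{2\pi}\int_{-K}^{K}e^{-ikx}G(k)\,dk$. The distance between two integrable functions $u,v$ on $[0,1]$ is $$d(u,v)=\frac{\int_0^1|u(x)-v(x)|\,dx}{\int_0^1dx}=\int_0^1|u(x)-v(x)|\,dx.$$ *)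

theory Defs
  imports "HOL-Analysis.Analysis"
begin

text \<open>
  Functions on the unit interval are represented by total functions on the reals; every notion
  below depends only on their values on \<^term>\<open>{0..1::real}\<close>.
\<close>

definition unit_pdf :: "(real \<Rightarrow> real) \<Rightarrow> bool" where
  "unit_pdf f \<longleftrightarrow>
     (\<forall>x\<in>{0..1}. 0 \<le> f x) \<and>
     set_integrable lebesgue {0..1} f \<and>
     (LINT x:{0..1}|lebesgue. f x) = 1"

definition moment :: "(real \<Rightarrow> real) \<Rightarrow> nat \<Rightarrow> real" where
  "moment f j = (LINT x:{0..1}|lebesgue. x ^ j * f x)"

definition char_fun :: "(real \<Rightarrow> real) \<Rightarrow> real \<Rightarrow> complex" where
  "char_fun f k =
     (LINT x:{0..1}|lebesgue. exp (\<i> * complex_of_real (k * x)) * complex_of_real (f x))"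

text \<open>
  The filtered function is kept complex-valued, as the defining integral is. Its values are in
  fact real, because the characteristic function of a real \<open>f\<close> is conjugate-symmetric.
\<close>

definition low_pass :: "real \<Rightarrow> (real \<Rightarrow> real) \<Rightarrow> real \<Rightarrow> complex" where
  "low_pass K f x =
     complex_of_real (1 / (2 * pi)) *
     (LINT k:{-K..K}|lebesgue. exp (- (\<i> * complex_of_real (k * x))) * char_fun f k)"

definition unit_dist :: "(real \<Rightarrow> complex) \<Rightarrow> (real \<Rightarrow> complex) \<Rightarrow> real" where
  "unit_dist u v = (LINT x:{0..1}|lebesgue. cmod (u x - v x))"

end

theory Submission
  imports Defs "HOL-Probability.Characteristic_Functions"
begin

text \<open>
  On \<open>[0,1]\<close> a density has all its moments, and they are the Taylor coefficients of its
  characteristic function \<open>F\<close>, up to the factors \<open>\<i>\<^sup>j / j!\<close>. Truncating the expansion of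
  \<open>e\<^bsup>ikx\<^esup>\<close> after the term of degree \<open>m = n - 1\<close> leaves a remainder of modulus at most
  \<open>\<bar>kx\<bar>\<^bsup>n\<^esup> / n!\<close>. Integrated against \<open>f\<close>, this is controlled by the moment of order \<open>n\<close>,
  and since \<open>x\<^bsup>n\<^esup> \<le> x\<^bsup>n-1\<^esup>\<close> on \<open>[0,1]\<close> also by the moment of order \<open>n - 1\<close>, the last one
  used in the expansion (\<open>char_fun_taylor\<close>). Subtracting the expansions of \<open>F\<close> and \<open>G\<close>
  (\<open>char_fun_diff_bound\<close>) and using \<open>M\<^sub>j\<close> for the difference of the \<open>j\<close>-th moments gives
  \<open>\<bar>F(k) - G(k)\<bar> \<le> \<Sum>\<^bsub>j<n\<^esub> M\<^sub>j \<bar>k\<bar>\<^sup>j / j! + R \<bar>k\<bar>\<^bsup>n\<^esup> / n!\<close>.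

  The difference of the filtered functions is the inverse Fourier integral of \<open>F - G\<close> over
  \<open>[-K,K]\<close>, so at every point it is at most \<open>1/(2\<pi>)\<close> times the integral of this bound
  (\<open>low_pass_diff_bound\<close>). As the integral of \<open>\<bar>k\<bar>\<^sup>j / j!\<close> over \<open>[-K,K]\<close> is
  \<open>2 K\<^bsup>j+1\<^esup> / (j+1)!\<close>, the result is precisely the polynomial of the cut-off equation, without
  its term \<open>-\<epsilon>\<close>. At a cut-off \<open>K\<close> the two filtered functions thus differ by at most \<open>\<epsilon>\<close>
  uniformly, and a fortiori in mean.

  That polynomial vanishes at \<open>0\<close> and has nonnegative coefficients. Its leading coefficient is
  positive because a density has positive moments (\<open>moment_pos\<close>). Hence it increases strictly from
  \<open>0\<close> to infinity on the half-line and takes the value \<open>\<epsilon>\<close> exactly once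
  (\<open>ex1_pos_root_nonneg_coeffs\<close>).
\<close>

section \<open>Moments and the Taylor expansion of the characteristic function\<close>

lemma set_integrable_continuous_mult:
  fixes h :: "real \<Rightarrow> 'a::{euclidean_space, real_normed_algebra_1}" and f :: "real \<Rightarrow> real"
  assumes h: "continuous_on {a..b} h" and f: "set_integrable lebesgue {a..b} f"
  shows "set_integrable lebesgue {a..b} (\<lambda>x. h x * of_real (f x))"
proof -
  have "(\<lambda>x. (\<lambda>z r. r *\<^sub>R z) (h x) (f x)) absolutely_integrable_on {a..b}"
  proof (rule absolutely_integrable_bounded_measurable_product[where f = h and g = f and h = "\<lambda>z r. r *\<^sub>R z"])
    show "bilinear (\<lambda>(z::'a) r. r *\<^sub>R z)"
      by (auto simp: bilinear_def intro!: linearI simp: algebra_simps)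
    show "h \<in> borel_measurable (lebesgue_on {a..b})"
      by (rule continuous_imp_measurable_on_sets_lebesgue[OF h]) simp
    show "bounded (h ` {a..b})"
      by (intro compact_imp_bounded compact_continuous_image h) simp
    show "f absolutely_integrable_on {a..b}"
      by (rule f)
  qed simp
  then show ?thesis
    by (simp add: of_real_def)
qed

lemma set_integrable_power_mult:
  fixes f :: "real \<Rightarrow> real"
  assumes "set_integrable lebesgue {0..1} f"
  shows "set_integrable lebesgue {0..1} (\<lambda>x. x ^ j * f x)"
  using set_integrable_continuous_mult[OF _ assms, of "\<lambda>x. x ^ j"]
  by (simp add: continuous_intros)

lemma set_integrable_iexp_mult:
  assumes "set_integrable lebesgue {0..1} f"
  shows "set_integrable lebesgue {0..1} (\<lambda>x. iexp (k * x) * complex_of_real (f x))"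
  by (rule set_integrable_continuous_mult[OF _ assms]) (intro continuous_intros)

text \<open>
  A vanishing moment would force \<open>x\<^sup>j f(x) = 0\<close> almost everywhere on \<open>[0,1]\<close>, and hence
  \<open>f = 0\<close> almost everywhere, because \<open>x\<^sup>j\<close> vanishes at most at the null set \<open>{0}\<close>. This
  contradicts the normalisation.
\<close>

lemma moment_pos:
  assumes "unit_pdf f"
  shows "moment f j > 0"
proof -
  have int: "set_integrable lebesgue {0..1} f" and nonneg: "\<And>x. x \<in> {0..1} \<Longrightarrow> 0 \<le> f x"
    and one: "(LINT x:{0..1}|lebesgue. f x) = 1"
    using assms by (auto simp: unit_pdf_def)
  let ?h = "\<lambda>x. indicator {0..1} x *\<^sub>R (x ^ j * f x)"
  have int_h: "integrable lebesgue ?h"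
    using set_integrable_power_mult[OF int, of j] by (simp add: set_integrable_def)
  have h_nonneg: "0 \<le> ?h x" for x
    using nonneg[of x] by (auto simp: indicator_def)
  have "moment f j \<noteq> 0"
  proof
    assume "moment f j = 0"
    then have "AE x in lebesgue. ?h x = 0"
      using integral_nonneg_eq_0_iff_AE[OF int_h] h_nonneg
      by (simp add: moment_def set_lebesgue_integral_def)
    moreover have "AE x in lebesgue. x \<noteq> (0::real)"
      by (rule AE_I'[of "{0}"]) (auto simp: null_sets_completionI)
    ultimately have "AE x in lebesgue. indicator {0..1} x *\<^sub>R f x = 0"
      by eventually_elim (auto simp: indicator_def)
    then have "(LINT x:{0..1}|lebesgue. f x) = 0"
      unfolding set_lebesgue_integral_def by (rule integral_eq_zero_AE)
    with one show False by simp
  qed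
  moreover have "moment f j \<ge> 0"
    unfolding moment_def set_lebesgue_integral_def using h_nonneg by (intro integral_nonneg_AE) auto
  ultimately show ?thesis by simp
qed

text \<open>
  The remainder after degree \<open>m\<close> naturally involves the moment of order \<open>m + 1\<close>. It is traded for
  that of order \<open>m\<close>, which is at least as large on \<open>[0,1]\<close> as \<open>f \<ge> 0\<close>, so that the bound uses only moments that already
  occur in the expansion.
\<close>

lemma char_fun_taylor:
  assumes "set_integrable lebesgue {0..1} f" and "\<And>x. x \<in> {0..1} \<Longrightarrow> 0 \<le> f x"
  shows "cmod (char_fun f k - (\<Sum>j\<le>m. (\<i> * of_real k) ^ j / fact j * of_real (moment f j)))
    \<le> moment f m / fact (Suc m) * \<bar>k\<bar> ^ Suc m"
proof -
  let ?c = "\<lambda>j. (\<i> * complex_of_real k) ^ j / fact j"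
  let ?T = "\<lambda>x. \<Sum>j\<le>m. ?c j * complex_of_real (x ^ j * f x)"
  let ?E = "\<lambda>x. iexp (k * x) * complex_of_real (f x)"
  have int_pow: "set_integrable lebesgue {0..1} (\<lambda>x. complex_of_real (x ^ j * f x))" for j
    using set_integrable_continuous_mult[OF _ assms(1), of "\<lambda>x. complex_of_real (x ^ j)"]
    by (simp add: continuous_intros)
  have int_term: "integrable lebesgue
      (\<lambda>x. indicator {0..1} x *\<^sub>R (?c j * complex_of_real (x ^ j * f x)))" for j
    using set_integrable_mult_right[OF int_pow, of "?c j" j] by (simp only: set_integrable_def)
  then have int_T: "set_integrable lebesgue {0..1} ?T"
    unfolding set_integrable_def scaleR_sum_right by (rule Bochner_Integration.integrable_sum)
  have T: "(LINT x:{0..1}|lebesgue. ?T x) = (\<Sum>j\<le>m. ?c j * of_real (moment f j))"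
  proof -
    have "(LINT x:{0..1}|lebesgue. ?T x)
      = (\<Sum>j\<le>m. LINT x:{0..1}|lebesgue. ?c j * complex_of_real (x ^ j * f x))"
      unfolding set_lebesgue_integral_def scaleR_sum_right
      by (rule Bochner_Integration.integral_sum[OF int_term])
    then show ?thesis
      by (simp only: set_integral_mult_right set_integral_complex_of_real moment_def)
  qed
  have int_E: "set_integrable lebesgue {0..1} ?E"
    by (rule set_integrable_iexp_mult[OF assms(1)])
  have "cmod (char_fun f k - (\<Sum>j\<le>m. ?c j * of_real (moment f j)))
    = cmod (LINT x:{0..1}|lebesgue. ?E x - ?T x)"
    by (simp only: set_integral_diff(2)[OF int_E int_T] T char_fun_def)
  also have "\<dots> \<le> (LINT x:{0..1}|lebesgue. cmod (?E x - ?T x))"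
    by (intro set_integral_norm_bound set_integral_diff int_E int_T)
  also have "\<dots> \<le> (LINT x:{0..1}|lebesgue. \<bar>k\<bar> ^ Suc m / fact (Suc m) * (x ^ m * f x))"
  proof (rule set_integral_mono)
    show "set_integrable lebesgue {0..1} (\<lambda>x. cmod (?E x - ?T x))"
      by (rule set_integrable_norm[OF set_integral_diff(1)[OF int_E int_T]])
    show "set_integrable lebesgue {0..1} (\<lambda>x. \<bar>k\<bar> ^ Suc m / fact (Suc m) * (x ^ m * f x))"
      by (intro set_integrable_mult_right set_integrable_power_mult assms)
    fix x :: real assume x: "x \<in> {0..1}"
    have "?E x - ?T x = (iexp (k * x) - (\<Sum>j\<le>m. (\<i> * of_real (k * x)) ^ j / fact j)) * of_real (f x)"
      unfolding left_diff_distrib sum_distrib_right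
      by (simp add: power_mult_distrib mult_ac)
    then have "cmod (?E x - ?T x)
      = cmod (iexp (k * x) - (\<Sum>j\<le>m. (\<i> * of_real (k * x)) ^ j / fact j)) * f x"
      using assms(2)[OF x] by (simp only: norm_mult norm_of_real abs_of_nonneg)
    also have "\<dots> \<le> \<bar>k * x\<bar> ^ Suc m / fact (Suc m) * f x"
      by (rule mult_right_mono[OF iexp_approx1 assms(2)[OF x]])
    also have "\<dots> = \<bar>k\<bar> ^ Suc m / fact (Suc m) * (x ^ Suc m * f x)"
      using x by (simp only: abs_mult power_mult_distrib) simp
    also have "\<dots> \<le> \<bar>k\<bar> ^ Suc m / fact (Suc m) * (x ^ m * f x)"
      using x assms(2)[OF x] by (intro mult_left_mono mult_right_mono power_decreasing) auto
    finally show "cmod (?E x - ?T x) \<le> \<bar>k\<bar> ^ Suc m / fact (Suc m) * (x ^ m * f x)" .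
  qed
  also have "\<dots> = moment f m / fact (Suc m) * \<bar>k\<bar> ^ Suc m"
    by (simp only: set_integral_mult_right moment_def[symmetric]) (simp add: mult_ac)
  finally show ?thesis .
qed

text \<open>
  The Taylor polynomials are compared coefficient by coefficient, so that only the differences of
  moments enter; the two remainders are simply added, whence the sum of moments in the last
  term.
\<close>

lemma char_fun_diff_bound:
  assumes f: "unit_pdf f" and g: "unit_pdf g"
  shows "cmod (char_fun f k - char_fun g k)
    \<le> (\<Sum>j\<le>m. \<bar>moment f j - moment g j\<bar> / fact j * \<bar>k\<bar> ^ j)
      + (moment f m + moment g m) / fact (Suc m) * \<bar>k\<bar> ^ Suc m"
proof -
  let ?c = "\<lambda>j. (\<i> * complex_of_real k) ^ j / fact j"
  let ?P = "\<lambda>h. \<Sum>j\<le>m. ?c j * complex_of_real (moment h j)"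
  have remainder: "cmod (char_fun h k - ?P h) \<le> moment h m / fact (Suc m) * \<bar>k\<bar> ^ Suc m"
    if "unit_pdf h" for h
    using that by (intro char_fun_taylor) (auto simp: unit_pdf_def)
  have "?P f - ?P g = (\<Sum>j\<le>m. ?c j * complex_of_real (moment f j - moment g j))"
    by (simp only: sum_subtractf[symmetric] right_diff_distrib[symmetric] of_real_diff)
  moreover have "cmod (\<Sum>j\<le>m. ?c j * complex_of_real (moment f j - moment g j))
    \<le> (\<Sum>j\<le>m. \<bar>moment f j - moment g j\<bar> / fact j * \<bar>k\<bar> ^ j)"
    by (rule sum_norm_le) (simp add: norm_mult norm_divide norm_power mult_ac del: of_real_diff)
  ultimately have polynomials: "cmod (?P f - ?P g)
    \<le> (\<Sum>j\<le>m. \<bar>moment f j - moment g j\<bar> / fact j * \<bar>k\<bar> ^ j)"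
    by (simp only:)
  have triangle: "cmod (a - b) \<le> cmod (p - q) + (cmod (a - p) + cmod (b - q))" for a b p q
    using norm_triangle_ineq[of "p - q" "(a - p) - (b - q)"] norm_triangle_ineq4[of "a - p" "b - q"]
    by simp
  show ?thesis
    unfolding add_divide_distrib distrib_right
    by (rule order_trans[OF triangle add_mono[OF polynomials
          add_mono[OF remainder[OF f] remainder[OF g]]]])
qed

section \<open>The low-pass filter\<close>

text \<open>
  Dominated convergence, with majorant \<open>\<bar>f\<bar>\<close>. Continuity is what makes the integrals over
  \<open>[-K,K]\<close> in the filter exist, so that they may be subtracted.
\<close>

lemma continuous_on_char_fun:
  assumes "set_integrable lebesgue {0..1} f"
  shows "continuous_on A (char_fun f)"
proof (intro continuous_at_imp_continuous_on ballI)
  fix t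
  show "isCont (char_fun f) t"
    unfolding continuous_at_sequentially
  proof safe
    fix X assume X: "X \<longlonglongrightarrow> t"
    show "(char_fun f \<circ> X) \<longlonglongrightarrow> char_fun f t"
      unfolding comp_def char_fun_def set_lebesgue_integral_def
    proof (rule integral_dominated_convergence)
      show "integrable lebesgue (\<lambda>x. \<bar>indicator {0..1} x *\<^sub>R f x\<bar>)"
        using assms by (intro integrable_abs) (simp add: set_integrable_def)
      show "(\<lambda>x. indicator {0..1} x *\<^sub>R (iexp (k * x) * complex_of_real (f x)))
          \<in> borel_measurable lebesgue" for k
        using set_integrable_iexp_mult[OF assms, of k]
        by (intro borel_measurable_integrable) (simp add: set_integrable_def)
      then show "(\<lambda>x. indicator {0..1} x *\<^sub>R (iexp (X i * x) * complex_of_real (f x)))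
          \<in> borel_measurable lebesgue" for i .
      show "AE x in lebesgue. (\<lambda>i. indicator {0..1} x *\<^sub>R (iexp (X i * x) * complex_of_real (f x)))
          \<longlonglongrightarrow> indicator {0..1} x *\<^sub>R (iexp (t * x) * complex_of_real (f x))"
        by (intro AE_I2 tendsto_intros X)
      show "AE x in lebesgue. norm (indicator {0..1} x *\<^sub>R (iexp (X i * x) * complex_of_real (f x)))
          \<le> \<bar>indicator {0..1} x *\<^sub>R f x\<bar>" for i
        by (intro AE_I2) (simp add: norm_mult abs_mult del: of_real_mult)
    qed
  qed
qed

lemma low_pass_diff_bound:
  assumes f: "set_integrable lebesgue {0..1} f" and g: "set_integrable lebesgue {0..1} g"
    and B: "(B has_integral I) {-K..K}"
    and le: "\<And>k. cmod (char_fun f k - char_fun g k) \<le> B k"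
  shows "cmod (low_pass K f x - low_pass K g x) \<le> I / (2 * pi)"
proof -
  let ?e = "\<lambda>k. exp (- (\<i> * complex_of_real (k * x)))"
  have int: "set_integrable lebesgue {-K..K} (\<lambda>k. ?e k * char_fun h k)"
    if "set_integrable lebesgue {0..1} h" for h
    by (intro absolutely_integrable_continuous_real continuous_intros
        continuous_on_char_fun[OF that])
  have int_d: "set_integrable lebesgue {-K..K} (\<lambda>k. ?e k * char_fun f k - ?e k * char_fun g k)"
    by (rule set_integral_diff(1)[OF int[OF f] int[OF g]])
  have "low_pass K f x - low_pass K g x = complex_of_real (1 / (2 * pi)) *
      integral {-K..K} (\<lambda>k. ?e k * char_fun f k - ?e k * char_fun g k)"
    unfolding low_pass_def set_lebesgue_integral_eq_integral(2)[OF int_d, symmetric]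
      set_integral_diff(2)[OF int[OF f] int[OF g]] by (simp only: right_diff_distrib)
  moreover have "cmod (integral {-K..K} (\<lambda>k. ?e k * char_fun f k - ?e k * char_fun g k))
      \<le> integral {-K..K} B"
  proof (rule Henstock_Kurzweil_Integration.integral_norm_bound_integral)
    show "(\<lambda>k. ?e k * char_fun f k - ?e k * char_fun g k) integrable_on {-K..K}"
      by (rule set_lebesgue_integral_eq_integral(1)[OF int_d])
    show "B integrable_on {-K..K}"
      using B by (rule has_integral_integrable)
    show "cmod (?e k * char_fun f k - ?e k * char_fun g k) \<le> B k" for k
      using le[of k] by (simp add: right_diff_distrib[symmetric] norm_mult)
  qed
  ultimately have "cmod (low_pass K f x - low_pass K g x) \<le> 1 / (2 * pi) * integral {-K..K} B"
    by (simp only: norm_mult norm_of_real) (simp add: divide_right_mono)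
  then show ?thesis
    using integral_unique[OF B] by simp
qed

text \<open>
  The interval has length \<open>1\<close>, so a uniform bound is a bound for the mean. If the integrand is not
  integrable, its integral is \<open>0\<close> by convention, and the bound holds because \<open>c\<close> dominates a norm.
\<close>

lemma unit_dist_le:
  assumes "\<And>x. cmod (u x - v x) \<le> c"
  shows "unit_dist u v \<le> c"
proof -
  have "c \<ge> 0"
    using norm_ge_zero assms by (rule order_trans)
  show ?thesis
  proof (cases "set_integrable lebesgue {0..1} (\<lambda>x. cmod (u x - v x))")
    case True
    then have "unit_dist u v \<le> (LINT x:{0..1::real}|lebesgue. c)"
      unfolding unit_dist_def
      by (rule set_integral_mono) (auto simp: assms intro: absolutely_integrable_continuous_real)
    then show ?thesis
      by (simp add: set_integral_const)
  next
    case False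
    then show ?thesis
      using \<open>c \<ge> 0\<close>
      by (simp add: unit_dist_def set_lebesgue_integral_def set_integrable_def
          not_integrable_integral_eq)
  qed
qed

lemma has_integral_abs_power:
  fixes K :: real
  assumes "K \<ge> 0"
  shows "((\<lambda>k. \<bar>k\<bar> ^ j) has_integral 2 * K ^ Suc j / Suc j) {-K..K}"
proof -
  have "((\<lambda>k. k ^ j) has_integral K ^ Suc j / Suc j - 0 ^ Suc j / Suc j) {0..K}"
    by (rule fundamental_theorem_of_calculus[OF assms])
      (auto simp: has_real_derivative_iff_has_vector_derivative[symmetric] simp del: power_Suc
        intro!: derivative_eq_intros)
  then have right: "((\<lambda>k. \<bar>k\<bar> ^ j) has_integral K ^ Suc j / Suc j) {0..K}"
    by (subst has_integral_cong[of _ _ "\<lambda>k. k ^ j"]) auto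
  then have "((\<lambda>k. \<bar>k\<bar> ^ j) has_integral K ^ Suc j / Suc j) {-K..0}"
    using has_integral_reflect_real[of "\<lambda>k. \<bar>k\<bar> ^ j" _ K 0] by simp
  from has_integral_combine[OF _ _ this right] assms show ?thesis
    by simp
qed

section \<open>The cut-off equation\<close>

text \<open>
  One positive coefficient on a positive power makes the sum strictly increasing and unbounded on
  the half-line; the intermediate value theorem gives existence and monotonicity uniqueness.
\<close>

lemma ex1_pos_root_nonneg_coeffs:
  fixes a :: "nat \<Rightarrow> real" and b c :: real
  assumes a: "\<And>j. j \<le> m \<Longrightarrow> a j \<ge> 0" and b: "b > 0" and c: "c > 0"
  shows "\<exists>!K. K > 0 \<and> (\<Sum>j\<le>m. a j * K ^ Suc j) + b * K ^ Suc N = c"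
proof -
  let ?p = "\<lambda>K. (\<Sum>j\<le>m. a j * K ^ Suc j) + b * K ^ Suc N"
  have strict: "?p x < ?p y" if "0 \<le> x" "x < y" for x y
  proof (rule add_le_less_mono)
    show "(\<Sum>j\<le>m. a j * x ^ Suc j) \<le> (\<Sum>j\<le>m. a j * y ^ Suc j)"
      using that a by (intro sum_mono mult_left_mono power_mono) auto
    show "b * x ^ Suc N < b * y ^ Suc N"
      using that b by (intro mult_strict_left_mono power_strict_mono) auto
  qed
  \<comment> \<open>Since \<open>Y \<ge> 1\<close>, its powers are at least \<open>Y\<close>, so the single term \<open>b Y\<^bsup>N+1\<^esup>\<close> already reaches \<open>c\<close>.\<close>
  define Y where "Y = max 1 (c / b)"
  have "Y \<ge> 1" and "b * Y \<ge> c"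
    using b by (auto simp: Y_def max_def field_simps)
  have "c \<le> b * Y ^ Suc N"
    using \<open>b * Y \<ge> c\<close> \<open>Y \<ge> 1\<close> b self_le_power[of Y "Suc N"]
    by (smt (verit) mult_left_mono zero_less_Suc)
  also have "\<dots> \<le> ?p Y"
    using a \<open>Y \<ge> 1\<close> sum_nonneg[of "{..m}" "\<lambda>j. a j * Y ^ Suc j"] by simp
  finally have "c \<le> ?p Y" .
  moreover have "?p 0 \<le> c"
    using c by simp
  moreover have "continuous_on {0..Y} ?p"
    by (intro continuous_intros)
  ultimately obtain K where K: "0 \<le> K" "?p K = c"
    using IVT'[of ?p 0 c Y] \<open>Y \<ge> 1\<close> by auto
  have "K \<noteq> 0"
    using K(2) c by auto
  show ?thesis
  proof (rule ex1I[of _ K])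
    show "K > 0 \<and> ?p K = c"
      using K \<open>K \<noteq> 0\<close> by auto
    show "L = K" if "L > 0 \<and> ?p L = c" for L
      using strict[of L K] strict[of K L] that K by (cases L K rule: linorder_cases) auto
  qed
qed

theorem proposition1:
  fixes f g :: "real \<Rightarrow> real" and n :: nat and M :: "nat \<Rightarrow> real" and R \<epsilon> :: real
  assumes "unit_pdf f" and "unit_pdf g"
    and "n \<ge> 1"
    and "\<And>j. j \<le> n - 1 \<Longrightarrow> M j \<ge> \<bar>moment f j - moment g j\<bar>"
    and "R = moment f (n - 1) + moment g (n - 1)"
    and "\<epsilon> > 0"
  defines "cutoff \<equiv> \<lambda>K::real. K > 0 \<and>
      1 / pi * ((\<Sum>j = 0..n - 1. M j / fact (j + 1) * K ^ (j + 1))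
                + R / fact (n + 1) * K ^ (n + 1)) - \<epsilon> = 0"
  shows "(\<exists>!K. cutoff K) \<and>
         (\<forall>K. cutoff K \<longrightarrow> unit_dist (low_pass K f) (low_pass K g) \<le> \<epsilon>)"
proof -
  obtain m where n: "n = Suc m"
    using \<open>n \<ge> 1\<close> by (cases n) auto
  have M: "\<bar>moment f j - moment g j\<bar> \<le> M j" if "j \<le> m" for j
    using assms(4)[of j] that n by simp
  have R: "R = moment f m + moment g m"
    using assms(5) n by simp
  have f: "set_integrable lebesgue {0..1} f" and g: "set_integrable lebesgue {0..1} g"
    using assms(1,2) by (auto simp: unit_pdf_def)
  let ?p = "\<lambda>K. (\<Sum>j\<le>m. M j / fact (Suc j) * K ^ Suc j)
    + R / fact (Suc (Suc m)) * K ^ Suc (Suc m)"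
  have "cutoff K \<longleftrightarrow> K > 0 \<and> 1 / pi * ?p K - \<epsilon> = 0" for K
    unfolding cutoff_def n by (simp only: Suc_eq_plus1[symmetric] diff_Suc_1 atMost_atLeast0)
  moreover have "1 / pi * z - \<epsilon> = 0 \<longleftrightarrow> z = pi * \<epsilon>" for z
    by (auto simp: field_simps)
  ultimately have cutoff_iff: "cutoff K \<longleftrightarrow> K > 0 \<and> ?p K = pi * \<epsilon>" for K
    by (simp only:)
  have "\<exists>!K. cutoff K"
    unfolding cutoff_iff
  proof (rule ex1_pos_root_nonneg_coeffs)
    show "0 \<le> M j / fact (Suc j)" if "j \<le> m" for j
      using order_trans[OF abs_ge_zero M[OF that]] by simp
    show "0 < R / fact (Suc (Suc m))"
      using moment_pos[OF assms(1), of m] moment_pos[OF assms(2), of m] by (simp add: R)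
    show "0 < pi * \<epsilon>"
      using \<open>\<epsilon> > 0\<close> by simp
  qed
  moreover have "unit_dist (low_pass K f) (low_pass K g) \<le> \<epsilon>" if "cutoff K" for K
  proof (rule unit_dist_le)
    fix x
    have K: "K > 0" "?p K = pi * \<epsilon>"
      using that by (auto simp: cutoff_iff)
    have coeff: "a / fact j * (2 * z / real (Suc j)) = 2 * (a / fact (Suc j) * z)"
      for a z :: real and j
      by (simp add: fact_Suc mult_ac)
    \<comment> \<open>The majorant of \<open>\<bar>F - G\<bar>\<close>; by \<open>coeff\<close> its integral over \<open>[-K,K]\<close> is twice the polynomial \<open>?p\<close>.\<close>
    let ?B = "\<lambda>k. (\<Sum>j\<le>m. M j / fact j * \<bar>k\<bar> ^ j) + R / fact (Suc m) * \<bar>k\<bar> ^ Suc m"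
    have "(?B has_integral (\<Sum>j\<le>m. M j / fact j * (2 * K ^ Suc j / Suc j))
        + R / fact (Suc m) * (2 * K ^ Suc (Suc m) / Suc (Suc m))) {-K..K}"
      using K(1)
      by (intro has_integral_add has_integral_sum has_integral_mult_right has_integral_abs_power) auto
    moreover have "(\<Sum>j\<le>m. M j / fact j * (2 * K ^ Suc j / Suc j))
        + R / fact (Suc m) * (2 * K ^ Suc (Suc m) / Suc (Suc m)) = 2 * ?p K"
      by (simp only: coeff distrib_left sum_distrib_left)
    ultimately have "(?B has_integral 2 * (pi * \<epsilon>)) {-K..K}"
      by (simp only: K(2))
    moreover have "cmod (char_fun f k - char_fun g k) \<le> ?B k" for k
    proof -
      have "(\<Sum>j\<le>m. \<bar>moment f j - moment g j\<bar> / fact j * \<bar>k\<bar> ^ j)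
        \<le> (\<Sum>j\<le>m. M j / fact j * \<bar>k\<bar> ^ j)"
        using M by (intro sum_mono mult_right_mono divide_right_mono) auto
      with char_fun_diff_bound[OF assms(1,2), of k m] show ?thesis
        unfolding R by linarith
    qed
    ultimately have "cmod (low_pass K f x - low_pass K g x) \<le> 2 * (pi * \<epsilon>) / (2 * pi)"
      by (rule low_pass_diff_bound[OF f g])
    then show "cmod (low_pass K f x - low_pass K g x) \<le> \<epsilon>"
      by simp
  qed
  ultimately show ?thesis
    by blast
qed

end
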